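(* For each scenario $k$ let $\Phi_{tk}$ be the parametric recourse problem $$\Phi_{tk}(s)=\min_{x}\{c_{tk}^{\top}x+\gamma\widehat Q_{t+1}(s'):\ s'-s-q_{tk}+u+w=0,\ x\in\mathcal X_{tk}\},$$ and let $\pi_{tk}$ denote an optimal dual multiplier of the storage-balance equality $s'-s-q_{tk}+u+w=0$ at the sampled state $\bar s$, with the sign convention that the corresponding Lagrangian term is $+\pi_{tk}(s'-s-q_{tk}+u+w)$. Assume strong duality holds for this problem at $\bar s$. Then $$-\pi_{tk}\in\partial\Phi_{tk}(\bar s).$$ For the probability-weighted stage value $Q_t(s)=\sum_k p_k\Phi_{tk}(s)$, a valid subgradient at $\bar s$ is $$\beta_t=-\sum_k p_k\pi_{tk},$$ and the associated Benders cut is valid: for all $s$, $$Q_t(s)\ge Q_t(\bar s)+\beta_t(s-\bar s)=\alpha_t+\beta_t s,\qquad \alpha_t:=Q_t(\bar s)-\beta_t\bar s.$$ Hence the positive marginal water value under this sign convention (the negative of the cut slope) is $$\lambda_t^W=-\beta_t=\sum_k p_k\pi_{tk}.$$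
   Context: Fix a stage $t$ of a multistage storage problem. The scenarios $k$ are finitely many, with probabilities $p_k\ge 0$, $\sum_k p_k=1$. For each $k$, $s$ is the incoming storage, $q_{tk}$ the inflow, and the decision vector $x$ contains the outgoing storage $s'$, the turbine release $u$, the spill $w$, and possibly further variables (thermal generation, unserved energy); $c_{tk}$ is a cost vector, $\gamma\ge0$ a discount factor, $\mathcal X_{tk}$ a polyhedral feasible set not depending on $s$, and $\widehat Q_{t+1}$ a convex piecewise-affine continuation function (a maximum of finitely many affine cuts), so that the recourse problem is a linear program parametrized by $s$. Strong duality at $\bar s$ means: writing $d(\pi;s)=\inf_{x\in\mathcal X_{tk}}\{c_{tk}^{\top}x+\gamma\widehat Q_{t+1}(s')+\pi(s'-s-q_{tk}+u+w)\}$, one has $d(\pi_{tk};\bar s)=\Phi_{tk}(\bar s)$, a finite value, at the optimal multiplier $\pi_{tk}$. For the probability-weighted statements this is assumed for every $k$. The symbol $\partial$ denotes the convex subdifferential, i.e. $b\in\partial\Phi(\bar s)$ iff $\Phi(s)\ge\Phi(\bar s)+b(s-\bar s)$ for all $s$ (with $\Phi=+\infty$ at infeasible $s$). The marginal water value is the reduction in future cost per additional unit of storage as represented by the cut, i.e. the negative of the cut slope. *)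

theory Defs
  imports "HOL-Analysis.Analysis"
begin

text \<open>
  A decision vector is \<open>x :: real^'n\<close>; the coordinates \<open>out\<close>, \<open>tur\<close> and \<open>spl\<close> hold the outgoing
  storage, the turbine release and the spill, and the remaining coordinates (if any) are the
  further decision variables.
\<close>

definition storage_balance :: "'n::finite \<Rightarrow> 'n \<Rightarrow> 'n \<Rightarrow> real \<Rightarrow> real \<Rightarrow> real^'n \<Rightarrow> real" where
  "storage_balance out tur spl q s x = x $ out - s - q + x $ tur + x $ spl"

definition stage_cost :: "'n::finite \<Rightarrow> real^'n \<Rightarrow> real \<Rightarrow> (real \<Rightarrow> real) \<Rightarrow> real^'n \<Rightarrow> real" where
  "stage_cost out c \<gamma> Qhat x = c \<bullet> x + \<gamma> * Qhat (x $ out)"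

definition max_of_affine_cuts :: "(real \<Rightarrow> real) \<Rightarrow> bool" where
  "max_of_affine_cuts f \<longleftrightarrow>
     (\<exists>C :: (real \<times> real) set. finite C \<and> C \<noteq> {} \<and> (\<forall>s. f s = Max ((\<lambda>(a, b). a + b * s) ` C)))"

text \<open>
  The optimal value is extended-real: it is \<open>\<infinity>\<close> when no decision is feasible (infimum of the empty
  set) and \<open>-\<infinity>\<close> when the problem is unbounded. For a linear program a finite infimum is attained,
  so it is the minimum.
\<close>

definition recourse_value ::
  "'n::finite \<Rightarrow> 'n \<Rightarrow> 'n \<Rightarrow> real^'n \<Rightarrow> real \<Rightarrow> (real^'n) set \<Rightarrow> real \<Rightarrow> (real \<Rightarrow> real) \<Rightarrow> real \<Rightarrow> ereal" where
  "recourse_value out tur spl c q X \<gamma> Qhat s =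
     (INF x \<in> {x \<in> X. storage_balance out tur spl q s x = 0}. ereal (stage_cost out c \<gamma> Qhat x))"

definition dual_function ::
  "'n::finite \<Rightarrow> 'n \<Rightarrow> 'n \<Rightarrow> real^'n \<Rightarrow> real \<Rightarrow> (real^'n) set \<Rightarrow> real \<Rightarrow> (real \<Rightarrow> real) \<Rightarrow> real \<Rightarrow> real \<Rightarrow> ereal" where
  "dual_function out tur spl c q X \<gamma> Qhat \<mu> s =
     (INF x \<in> X. ereal (stage_cost out c \<gamma> Qhat x + \<mu> * storage_balance out tur spl q s x))"

definition optimal_multiplier ::
  "'n::finite \<Rightarrow> 'n \<Rightarrow> 'n \<Rightarrow> real^'n \<Rightarrow> real \<Rightarrow> (real^'n) set \<Rightarrow> real \<Rightarrow> (real \<Rightarrow> real) \<Rightarrow> real \<Rightarrow> real \<Rightarrow> bool" where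
  "optimal_multiplier out tur spl c q X \<gamma> Qhat s \<mu> \<longleftrightarrow>
     (\<forall>\<mu>'. dual_function out tur spl c q X \<gamma> Qhat \<mu>' s \<le> dual_function out tur spl c q X \<gamma> Qhat \<mu> s)"

definition strong_duality ::
  "'n::finite \<Rightarrow> 'n \<Rightarrow> 'n \<Rightarrow> real^'n \<Rightarrow> real \<Rightarrow> (real^'n) set \<Rightarrow> real \<Rightarrow> (real \<Rightarrow> real) \<Rightarrow> real \<Rightarrow> real \<Rightarrow> bool" where
  "strong_duality out tur spl c q X \<gamma> Qhat s \<mu> \<longleftrightarrow>
     dual_function out tur spl c q X \<gamma> Qhat \<mu> s = recourse_value out tur spl c q X \<gamma> Qhat s \<and>
     \<bar>recourse_value out tur spl c q X \<gamma> Qhat s\<bar> \<noteq> \<infinity>"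

definition subdifferential :: "(real \<Rightarrow> ereal) \<Rightarrow> real \<Rightarrow> real set" where
  "subdifferential f s0 = {b. \<forall>s. f s \<ge> f s0 + ereal (b * (s - s0))}"

text \<open>
  Arithmetic on \<^typ>\<open>ereal\<close> has \<open>0 * \<infinity> = 0\<close>, so a scenario of probability zero does not contribute
  to the weighted value even where it is infeasible; the cut inequality for this value implies the
  one for the convention \<open>0 * \<infinity> = \<infinity>\<close>.
\<close>

definition stage_value :: "'k set \<Rightarrow> ('k \<Rightarrow> real) \<Rightarrow> ('k \<Rightarrow> real \<Rightarrow> ereal) \<Rightarrow> real \<Rightarrow> ereal" where
  "stage_value K p \<Phi> s = (\<Sum>k\<in>K. ereal (p k) * \<Phi> k s)"

definition marginal_water_value :: "(real \<Rightarrow> real) \<Rightarrow> real \<Rightarrow> real" where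
  "marginal_water_value V s = - deriv V s"

end

theory Submission
  imports Defs
begin

text \<open>
  Changing the state from \<open>s0\<close> to \<open>s\<close> shifts the storage balance by a constant, so a decision
  feasible at \<open>s\<close> has Lagrangian value \<open>cost + \<mu> * (s - s0)\<close> at \<open>s0\<close>. This value is at least
  \<open>d(\<mu>; s0)\<close>, which is \<open>\<Phi>(s0)\<close> by strong duality; the infimum over the decisions feasible at \<open>s\<close>
  is the subgradient inequality. Nonnegative combinations of subgradients are subgradients of the
  weighted sum.
\<close>

text \<open>Since \<open>X\<close> does not depend on the state, \<open>x\<close> competes in the
  infimum defining the dual function at \<open>s0\<close>, even though it need not satisfy the
  balance there.\<close>

lemma dual_function_le_shifted_cost:
  assumes "x \<in> X" and "storage_balance out tur spl q s x = 0"
  shows "dual_function out tur spl c q X \<gamma> Qhat \<mu> s0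
           \<le> ereal (stage_cost out c \<gamma> Qhat x + \<mu> * (s - s0))"
proof -
  have "storage_balance out tur spl q s0 x = s - s0"
    using assms(2) by (simp add: storage_balance_def)
  then show ?thesis
    unfolding dual_function_def using assms(1) by (auto intro: INF_lower2)
qed

lemma neg_multiplier_in_subdifferential:
  assumes "strong_duality out tur spl c q X \<gamma> Qhat s0 \<mu>"
  shows "- \<mu> \<in> subdifferential (recourse_value out tur spl c q X \<gamma> Qhat) s0"
proof -
  \<comment> \<open>Finiteness is part of \<open>strong_duality\<close>; with a real value
    \<open>r\<close>, the term \<mu> * (s - s0) can be moved across the inequality.\<close>
  obtain r where r: "recourse_value out tur spl c q X \<gamma> Qhat s0 = ereal r"
    using assms unfolding strong_duality_def by auto
  then have d: "dual_function out tur spl c q X \<gamma> Qhat \<mu> s0 = ereal r"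
    using assms unfolding strong_duality_def by simp
  \<comment> \<open>An infeasible \<open>s\<close> needs no separate case: the infimum over the
    empty set is \<infinity>.\<close>
  have "ereal (r - \<mu> * (s - s0)) \<le> recourse_value out tur spl c q X \<gamma> Qhat s" for s
    unfolding recourse_value_def
  proof (rule INF_greatest)
    fix x assume "x \<in> {x \<in> X. storage_balance out tur spl q s x = 0}"
    then have "ereal r \<le> ereal (stage_cost out c \<gamma> Qhat x + \<mu> * (s - s0))"
      using dual_function_le_shifted_cost[of x X out tur spl q s c \<gamma> Qhat \<mu> s0] d by simp
    then show "ereal (r - \<mu> * (s - s0)) \<le> ereal (stage_cost out c \<gamma> Qhat x)"
      by simp
  qed
  then show ?thesis
    unfolding subdifferential_def using r by simp
qed

text \<open>Needed for the intercept of the cut: \<open>real_of_ereal\<close> returns the true stage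
  value only when that value is finite.\<close>

lemma stage_value_finite:
  assumes "\<And>k. k \<in> K \<Longrightarrow> \<bar>\<Phi> k s\<bar> \<noteq> \<infinity>"
  shows "\<bar>stage_value K p \<Phi> s\<bar> \<noteq> \<infinity>"
proof -
  have "ereal (p k) * \<Phi> k s = ereal (p k * real_of_ereal (\<Phi> k s))" if "k \<in> K" for k
    using assms[OF that] by (cases "\<Phi> k s") auto
  then have "stage_value K p \<Phi> s = ereal (\<Sum>k\<in>K. p k * real_of_ereal (\<Phi> k s))"
    unfolding stage_value_def by simp
  then show ?thesis by simp
qed

text \<open>Finiteness is required at \<open>s0\<close> only. There the scenario cuts can be summed
  in real arithmetic; at other states \<Phi> may be \<infinity>, so the comparison is made term by
  term in \<open>ereal\<close>.\<close>

lemma weighted_sum_in_subdifferential_stage_value: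
  assumes p: "\<And>k. k \<in> K \<Longrightarrow> p k \<ge> 0"
    and fin: "\<And>k. k \<in> K \<Longrightarrow> \<bar>\<Phi> k s0\<bar> \<noteq> \<infinity>"
    and b: "\<And>k. k \<in> K \<Longrightarrow> b k \<in> subdifferential (\<Phi> k) s0"
  shows "(\<Sum>k\<in>K. p k * b k) \<in> subdifferential (stage_value K p \<Phi>) s0"
proof -
  define r where "r k = real_of_ereal (\<Phi> k s0)" for k
  have r: "\<Phi> k s0 = ereal (r k)" if "k \<in> K" for k
    using fin[OF that] by (simp add: r_def ereal_real)
  have "stage_value K p \<Phi> s0 + ereal ((\<Sum>k\<in>K. p k * b k) * (s - s0)) \<le> stage_value K p \<Phi> s"
    for s
  proof -
    have "stage_value K p \<Phi> s0 = ereal (\<Sum>k\<in>K. p k * r k)"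
      unfolding stage_value_def using r by simp
    then have "stage_value K p \<Phi> s0 + ereal ((\<Sum>k\<in>K. p k * b k) * (s - s0))
        = (\<Sum>k\<in>K. ereal (p k) * ereal (r k + b k * (s - s0)))"
      by (simp add: sum_distrib_left sum.distrib sum_subtractf algebra_simps)
    also have "\<dots> \<le> (\<Sum>k\<in>K. ereal (p k) * \<Phi> k s)"
    proof (rule sum_mono)
      fix k assume k: "k \<in> K"
      then have "ereal (r k + b k * (s - s0)) \<le> \<Phi> k s"
        using b[OF k] r[OF k] by (simp add: subdifferential_def)
      \<comment> \<open>Where \<open>p k\<close> is zero both sides vanish, even if the scenario is
        infeasible at \<open>s\<close>.\<close>
      then show "ereal (p k) * ereal (r k + b k * (s - s0)) \<le> ereal (p k) * \<Phi> k s"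
        using p[OF k] by (intro ereal_mult_left_mono) simp_all
    qed
    finally show ?thesis by (simp add: stage_value_def)
  qed
  then show ?thesis by (simp add: subdifferential_def)
qed

text \<open>\<open>deriv\<close> is defined by choice, so an actual derivative has to be exhibited.
  It exists at every state because the cut is affine, whereas the stage value itself may have
  kinks.\<close>

lemma marginal_water_value_affine: "marginal_water_value (\<lambda>s. \<alpha> + \<beta> * s) s = - \<beta>"
proof -
  have "((\<lambda>s. \<alpha> + \<beta> * s) has_field_derivative \<beta>) (at s)"
    by (auto intro!: derivative_eq_intros)
  then show ?thesis
    by (simp add: marginal_water_value_def DERIV_imp_deriv)
qed

theorem proposition6:
  fixes K :: "'k set"
    and p q \<pi> :: "'k \<Rightarrow> real"
    and c :: "'k \<Rightarrow> real^'n"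
    and X :: "'k \<Rightarrow> (real^'n) set"
    and out tur spl :: 'n
    and \<gamma> sbar \<alpha> \<beta> :: real
    and Qhat :: "real \<Rightarrow> real"
    and \<Phi> :: "'k \<Rightarrow> real \<Rightarrow> ereal"
    and Q :: "real \<Rightarrow> ereal"
  assumes "finite K"
    and "\<forall>k\<in>K. p k \<ge> 0"
    and "(\<Sum>k\<in>K. p k) = 1"
    and "distinct [out, tur, spl]"
    and "\<forall>k\<in>K. polyhedron (X k)"
    and "\<gamma> \<ge> 0"
    and "max_of_affine_cuts Qhat"
    and "\<Phi> = (\<lambda>k s. recourse_value out tur spl (c k) (q k) (X k) \<gamma> Qhat s)"
    and "Q = (\<lambda>s. stage_value K p \<Phi> s)"
    and "\<beta> = - (\<Sum>k\<in>K. p k * \<pi> k)"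
    and "\<alpha> = real_of_ereal (Q sbar) - \<beta> * sbar"
  shows "(\<forall>k\<in>K. optimal_multiplier out tur spl (c k) (q k) (X k) \<gamma> Qhat sbar (\<pi> k) \<and>
                strong_duality out tur spl (c k) (q k) (X k) \<gamma> Qhat sbar (\<pi> k)
            \<longrightarrow> - \<pi> k \<in> subdifferential (\<Phi> k) sbar) \<and>
         ((\<forall>k\<in>K. optimal_multiplier out tur spl (c k) (q k) (X k) \<gamma> Qhat sbar (\<pi> k) \<and>
                 strong_duality out tur spl (c k) (q k) (X k) \<gamma> Qhat sbar (\<pi> k))
            \<longrightarrow> \<beta> \<in> subdifferential Q sbar \<and>
                (\<forall>s. Q s \<ge> Q sbar + ereal (\<beta> * (s - sbar)) \<and>
                     Q sbar + ereal (\<beta> * (s - sbar)) = ereal (\<alpha> + \<beta> * s)) \<and>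
                (\<forall>s. marginal_water_value (\<lambda>s. \<alpha> + \<beta> * s) s = - \<beta>) \<and>
                - \<beta> = (\<Sum>k\<in>K. p k * \<pi> k))"
proof (intro conjI impI)
  show "\<forall>k\<in>K. optimal_multiplier out tur spl (c k) (q k) (X k) \<gamma> Qhat sbar (\<pi> k) \<and>
                strong_duality out tur spl (c k) (q k) (X k) \<gamma> Qhat sbar (\<pi> k)
            \<longrightarrow> - \<pi> k \<in> subdifferential (\<Phi> k) sbar"
    using assms(8) by (simp add: neg_multiplier_in_subdifferential)
next
  assume sd: "\<forall>k\<in>K. optimal_multiplier out tur spl (c k) (q k) (X k) \<gamma> Qhat sbar (\<pi> k) \<and>
                 strong_duality out tur spl (c k) (q k) (X k) \<gamma> Qhat sbar (\<pi> k)"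
  have Q: "Q = stage_value K p \<Phi>"
    using assms(9) by simp
  have fin: "\<bar>\<Phi> k sbar\<bar> \<noteq> \<infinity>" if "k \<in> K" for k
    using sd that assms(8) by (simp add: strong_duality_def)
  have sub: "- \<pi> k \<in> subdifferential (\<Phi> k) sbar" if "k \<in> K" for k
    using sd that assms(8) by (simp add: neg_multiplier_in_subdifferential)
  have "(\<Sum>k\<in>K. p k * - \<pi> k) \<in> subdifferential (stage_value K p \<Phi>) sbar"
    using assms(2) fin sub by (intro weighted_sum_in_subdifferential_stage_value) auto
  then show \<beta>: "\<beta> \<in> subdifferential Q sbar"
    using assms(10) Q by (simp add: sum_negf)
  have "\<bar>Q sbar\<bar> \<noteq> \<infinity>"
    unfolding Q using fin by (rule stage_value_finite)
  \<comment> \<open>With \<open>Q sbar\<close> real, the part - \<beta> * sbar of \<alpha> turns the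
    cut anchored at \<open>sbar\<close> into slope-intercept form.\<close>
  then obtain r where "Q sbar = ereal r"
    by auto
  then have "Q sbar + ereal (\<beta> * (s - sbar)) = ereal (\<alpha> + \<beta> * s)" for s
    using assms(11) by (simp add: algebra_simps)
  then show "\<forall>s. Q s \<ge> Q sbar + ereal (\<beta> * (s - sbar)) \<and>
                 Q sbar + ereal (\<beta> * (s - sbar)) = ereal (\<alpha> + \<beta> * s)"
    using \<beta> unfolding subdifferential_def by blast
  show "\<forall>s. marginal_water_value (\<lambda>s. \<alpha> + \<beta> * s) s = - \<beta>"
    by (simp add: marginal_water_value_affine)
  show "- \<beta> = (\<Sum>k\<in>K. p k * \<pi> k)"
    using assms(10) by simp
qed

end
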